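(* Let $\alpha>2$, let $z\colon[t_0,+\infty)\to\mathcal H$ be a solution of the dynamical system (DS) described in the context, and assume that $\beta\colon[t_0,+\infty)\to(0,+\infty)$ satisfies $$0\le\sup_{t\ge t_0}\frac{t\dot\beta(t)}{\beta(t)}<\alpha-2.$$ Then $z(t)$ converges weakly, as $t\to+\infty$, to a solution of the equation $V(z)=0$.
   Context: $\mathcal H$ is a real Hilbert space, $V\colon\mathcal H\to\mathcal H$ is monotone ($\langle x-y,V(x)-V(y)\rangle\ge0$ for all $x,y\in\mathcal H$) and continuous, and $\mathcal Z:=\{z\in\mathcal H: V(z)=0\}$ is assumed nonempty. Let $t_0>0$, $(z^0,\dot z^0)\in\mathcal H\times\mathcal H$, and let $\beta\colon[t_0,+\infty)\to(0,+\infty)$ be continuously differentiable and nondecreasing. The dynamical system (DS) on $[t_0,+\infty)$ is $$\ddot z(t)+\frac{\alpha}{t}\dot z(t)+\beta(t)\frac{d}{dt}V(z(t))+\frac12\Big(\dot\beta(t)+\frac{\alpha}{t}\beta(t)\Big)V(z(t))=0,\qquad z(t_0)=z^0,\ \dot z(t_0)=\dot z^0.$$ For a solution $z$, the map $t\mapsto V(z(t))$ is assumed to be differentiable on $[t_0,+\infty)$. *)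

theory Defs
  imports "HOL-Analysis.Analysis"
begin

definition monotone_operator :: "('a::real_inner \<Rightarrow> 'a) \<Rightarrow> bool" where
  "monotone_operator V \<longleftrightarrow> (\<forall>x y. (x - y) \<bullet> (V x - V y) \<ge> 0)"

text \<open>Functions on the half-line with left end point \<open>t0\<close> are total functions whose values
  to the left of \<open>t0\<close> are irrelevant; accordingly the derivative at \<open>t0\<close> is the right-hand one.\<close>

definition time_deriv :: "real \<Rightarrow> (real \<Rightarrow> 'a::real_normed_vector) \<Rightarrow> real \<Rightarrow> 'a" where
  "time_deriv t0 f t = vector_derivative f (at t within {t0..})"

text \<open>The value of \<^const>\<open>time_deriv\<close> is meaningless at points of non-differentiability, so
  the differentiability of \<open>z\<close>, of its derivative and of \<open>V \<circ> z\<close> is part of being a solution.\<close>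

definition DS_solution ::
  "('a::real_inner \<Rightarrow> 'a) \<Rightarrow> real \<Rightarrow> (real \<Rightarrow> real) \<Rightarrow> real \<Rightarrow> 'a \<Rightarrow> 'a \<Rightarrow> (real \<Rightarrow> 'a) \<Rightarrow> bool" where
  "DS_solution V \<alpha> \<beta> t0 z0 v0 z \<longleftrightarrow>
     z differentiable_on {t0..} \<and>
     time_deriv t0 z differentiable_on {t0..} \<and>
     (\<lambda>t. V (z t)) differentiable_on {t0..} \<and>
     (\<forall>t\<ge>t0.
        time_deriv t0 (time_deriv t0 z) t + (\<alpha> / t) *\<^sub>R time_deriv t0 z t
        + \<beta> t *\<^sub>R time_deriv t0 (\<lambda>s. V (z s)) t
        + ((1/2) * (time_deriv t0 \<beta> t + (\<alpha> / t) * \<beta> t)) *\<^sub>R V (z t) = 0) \<and>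
     z t0 = z0 \<and> time_deriv t0 z t0 = v0"

definition weakly_converges :: "('b \<Rightarrow> 'a::real_inner) \<Rightarrow> 'a \<Rightarrow> 'b filter \<Rightarrow> bool" where
  "weakly_converges f l F \<longleftrightarrow> (\<forall>u. ((\<lambda>t. f t \<bullet> u) \<longlongrightarrow> l \<bullet> u) F)"

end

theory Submission
  imports Defs
begin

text \<open>
  Write \<open>v\<close> for the velocity of the trajectory \<open>z\<close> and \<open>W t = V (z t)\<close>. The proof is a Lyapunov
  argument followed by Opial's lemma.

  Fix a zero \<open>s\<close> of \<open>V\<close>, put \<open>x = z - s\<close>, and let \<open>\<epsilon> > 0\<close> be the gap between \<open>\<alpha> - 2\<close> and the
  supremum of \<open>t \<beta>'(t) / \<beta>(t)\<close>. There is a one-parameter family of energies, quadratic in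
  \<open>(x, v, W)\<close>, whose derivative along the trajectory splits into a part that is nonpositive
  because \<open>V\<close> is monotone, through \<open>x \<bullet> W \<ge> 0\<close> and \<open>v \<bullet> W' \<ge> 0\<close>, and a negative semidefinite
  quadratic form in \<open>v\<close> and \<open>W\<close>; the form has this sign for all parameters \<open>\<mu> \<in> [0, \<epsilon>]\<close>. So each
  of these energies decreases to a limit, which yields three facts:

  \<^item> \<open>t \<beta>(t) \<parallel>W(t)\<parallel>\<close> is bounded, hence \<open>W(t) \<rightarrow> 0\<close> because \<open>\<beta>\<close> is nondecreasing
    (\<open>scaled_W_bounded\<close>);
  \<^item> \<open>\<beta> (x \<bullet> W)\<close> is integrable on the half-line (\<open>integral_xW_convergent\<close>);
  \<^item> the difference of two members of the family converges. Up to a factor it equals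
    \<open>(\<alpha> - 1) h + t h' + t \<beta> (x \<bullet> W)\<close> with \<open>h = \<parallel>x\<parallel>\<^sup>2 / 2\<close>, because the terms quadratic in \<open>(v, W)\<close>
    do not depend on the parameter.

  With \<open>q(t) = h(t) + \<integral>\<beta> (x \<bullet> W)\<close>, the integral being taken up to time \<open>t\<close>, the last two facts say
  that \<open>(\<alpha> - 1) q + t q'\<close> converges. Then \<open>q\<close> itself converges, and so does the distance
  \<open>\<parallel>z(t) - s\<parallel>\<close> (\<open>distance_convergent\<close>).

  A weak cluster point of the trajectory is a zero of \<open>V\<close>, because \<open>W \<rightarrow> 0\<close> and the graph of a
  continuous monotone operator is closed in the weak-strong topology
  (\<open>monotone_weak_strong_closed\<close>). Opial's lemma then gives weak convergence: bounded
  trajectories have weak cluster points (\<open>bounded_imp_weak_cluster_point\<close>, from Tychonoff's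
  theorem and the Riesz representation), and two cluster points to which the distance
  converges coincide.
\<close>

section \<open>Weak cluster points in a Hilbert space\<close>

lemma parallelogram_half:
  fixes u v :: "'a::real_inner"
  shows "(norm (u - v))\<^sup>2 = 2 * (norm u)\<^sup>2 + 2 * (norm v)\<^sup>2 - 4 * (norm ((1/2) *\<^sub>R (u + v)))\<^sup>2"
  unfolding power2_norm_eq_inner
  by (simp add: inner_commute algebra_simps)

text \<open>
  The representing vector is the minimiser of the functional \<open>J u = \<parallel>u\<parallel>\<^sup>2 - 2 \<phi>(u)\<close>. The
  parallelogram law makes minimising sequences of \<open>J\<close> Cauchy, and the first variation of \<open>J\<close>
  at its minimiser \<open>a\<close> is twice \<open>a \<bullet> u - \<phi>(u)\<close>.
\<close>

lemma Riesz_representation: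
  fixes \<phi> :: "'a::{real_inner, complete_space} \<Rightarrow> real"
  assumes "bounded_linear \<phi>"
  obtains a where "\<And>u. \<phi> u = a \<bullet> u"
proof -
  interpret \<phi>: bounded_linear \<phi> by fact
  define J where "J = (\<lambda>u. (norm u)\<^sup>2 - 2 * \<phi> u)"
  obtain K where K: "\<And>u. norm (\<phi> u) \<le> norm u * K"
    using \<phi>.bounded by blast
  have J_ge: "J u \<ge> - K\<^sup>2" for u
  proof -
    have "J u \<ge> (norm u)\<^sup>2 - 2 * (norm u * K)"
      using K[of u] unfolding J_def by auto
    moreover have "(norm u - K)\<^sup>2 \<ge> 0" by simp
    ultimately show ?thesis by (simp add: power2_diff)
  qed
  define d where "d = Inf (range J)"
  have bdd: "bdd_below (range J)"
    using J_ge by (intro bdd_belowI[of _ "- K\<^sup>2"]) auto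
  have d_le: "d \<le> J u" for u
    unfolding d_def using bdd by (intro cInf_lower) auto
  have "\<exists>u. J u < d + 1 / real (Suc n)" for n
  proof -
    have "Inf (range J) < d + 1 / real (Suc n)"
      by (simp add: d_def)
    then show ?thesis
      using cInf_less_iff[of "range J"] bdd by auto
  qed
  then obtain U where U: "\<And>n. J (U n) < d + 1 / real (Suc n)"
    by metis
  have J_conv: "(norm (u - v))\<^sup>2 \<le> 2 * (J u - d) + 2 * (J v - d)" for u v
  proof -
    have "(norm (u - v))\<^sup>2 = 2 * J u + 2 * J v - 4 * J ((1/2) *\<^sub>R (u + v))"
      using parallelogram_half[of u v]
      by (simp add: J_def \<phi>.add \<phi>.scaleR field_simps)
    with d_le[of "(1/2) *\<^sub>R (u + v)"] show ?thesis by simp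
  qed
  have "Cauchy U"
  proof (rule metric_CauchyI)
    fix e :: real assume "e > 0"
    then obtain N where N: "1 / real (Suc N) < e\<^sup>2 / 4"
      using nat_approx_posE[of "e\<^sup>2 / 4"] by auto
    have "dist (U m) (U n) < e" if "m \<ge> N" "n \<ge> N" for m n
    proof -
      have le: "1 / real (Suc k) \<le> 1 / real (Suc N)" if "k \<ge> N" for k
        using that by (simp add: frac_le)
      have "(dist (U m) (U n))\<^sup>2 \<le> 2 * (J (U m) - d) + 2 * (J (U n) - d)"
        unfolding dist_norm by (rule J_conv)
      also have "\<dots> < e\<^sup>2"
        using U[of m] U[of n] le[OF that(1)] le[OF that(2)] N by argo
      finally show ?thesis
        using \<open>e > 0\<close> by (simp add: power_less_imp_less_base)
    qed
    then show "\<exists>N. \<forall>m\<ge>N. \<forall>n\<ge>N. dist (U m) (U n) < e" by blast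
  qed
  then obtain a where a: "U \<longlonglongrightarrow> a"
    using Cauchy_convergent convergent_def by blast
  have "(\<lambda>n. J (U n)) \<longlonglongrightarrow> J a"
    unfolding J_def by (intro tendsto_intros \<phi>.tendsto a)
  moreover have "(\<lambda>n. d + 1 / real (Suc n)) \<longlonglongrightarrow> d + 0"
    by (intro tendsto_intros LIMSEQ_Suc[OF lim_inverse_n'])
  ultimately have "J a \<le> d"
    using U by (intro LIMSEQ_le[of "\<lambda>n. J (U n)"]) (auto intro: less_imp_le)
  then have J_min: "J a \<le> J u" for u
    using d_le[of u] by simp
  have "\<phi> u = a \<bullet> u" for u
  proof -
    define c where "c = a \<bullet> u - \<phi> u"
    define N where "N = (norm u)\<^sup>2"
    have N: "N \<ge> 0" by (simp add: N_def)
    \<comment> \<open>a step against the slope, short enough that the quadratic term cannot compensate it\<close>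
    define s where "s = - c / (N + 1)"
    have "J (a + s *\<^sub>R u) = J a + 2 * s * c + s\<^sup>2 * N"
      unfolding J_def c_def N_def power2_norm_eq_inner \<phi>.add \<phi>.scaleR
      by (simp add: algebra_simps inner_commute power2_eq_square)
    with J_min[of "a + s *\<^sub>R u"] have "2 * s * c + s\<^sup>2 * N \<ge> 0" by simp
    also have "c = - s * (N + 1)"
      using N by (simp add: s_def)
    finally have "s\<^sup>2 * (N + 2) \<le> 0"
      by (simp add: algebra_simps power2_eq_square)
    then have "s = 0"
      using N by (simp add: mult_le_0_iff)
    then show ?thesis
      using N by (simp add: s_def c_def)
  qed
  then show thesis by (rule that)
qed

text \<open>
  Weak compactness of balls, stated for filters so that neither separability nor subsequences
  enter: the functionals \<open>u \<mapsto> f t \<bullet> u\<close> lie in a product of compact intervals, which is compact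
  by Tychonoff's theorem. A cluster point in the product is a pointwise limit along a finer
  filter, hence linear and bounded, hence represented by a vector.
\<close>

lemma bounded_imp_weak_cluster_point:
  fixes f :: "'b \<Rightarrow> 'a::{real_inner, complete_space}"
  assumes "F \<noteq> bot" "\<forall>\<^sub>F t in F. norm (f t) \<le> M"
  obtains G a where "G \<le> F" "G \<noteq> bot" "weakly_converges f a G"
proof -
  define \<Phi> where "\<Phi> = (\<lambda>t u. f t \<bullet> u)"
  define B where "B = (\<Pi>\<^sub>E u\<in>(UNIV::'a set). {- (M * norm u)..M * norm u})"
  have "compactin (product_topology (\<lambda>_. euclidean) UNIV) B"
    unfolding B_def by (subst compactin_PiE) (auto simp: compactin_euclidean_iff)
  then have "compact B"
    by (simp add: euclidean_product_topology compactin_euclidean_iff)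
  moreover have "filtermap \<Phi> F \<noteq> bot"
    using assms(1) by (simp add: filtermap_bot_iff)
  moreover have "\<forall>\<^sub>F x in filtermap \<Phi> F. x \<in> B"
    unfolding eventually_filtermap using assms(2)
  proof eventually_elim
    case (elim t)
    have "\<bar>f t \<bullet> u\<bar> \<le> M * norm u" for u
      using Cauchy_Schwarz_ineq2[of "f t" u] mult_right_mono[OF elim, of "norm u"] by simp
    then show ?case
      by (simp add: \<Phi>_def B_def PiE_iff abs_le_iff) (metis minus_le_iff)
  qed
  ultimately obtain \<phi> where \<phi>: "\<phi> \<in> B" and inf: "inf (nhds \<phi>) (filtermap \<Phi> F) \<noteq> bot"
    using compact_filter[of B] by blast
  define G where "G = inf F (filtercomap \<Phi> (nhds \<phi>))"
  have G_le: "G \<le> F" by (simp add: G_def)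
  have G: "G \<noteq> bot"
  proof
    assume "G = bot"
    then have "eventually (\<lambda>_. False) G" by simp
    then obtain P Q where P: "eventually P F" and Q: "eventually Q (nhds \<phi>)"
      and PQ: "\<And>t. P t \<Longrightarrow> Q (\<Phi> t) \<Longrightarrow> False"
      unfolding G_def eventually_inf eventually_filtercomap by blast
    have "eventually (\<lambda>x. \<not> Q x) (filtermap \<Phi> F)"
      unfolding eventually_filtermap using P by eventually_elim (use PQ in auto)
    with Q have "eventually (\<lambda>_. False) (inf (nhds \<phi>) (filtermap \<Phi> F))"
      unfolding eventually_inf by blast
    with inf show False by (simp add: eventually_False)
  qed
  have "filterlim \<Phi> (nhds \<phi>) G"
    unfolding filterlim_iff_le_filtercomap G_def by simp
  then have lim: "((\<lambda>t. f t \<bullet> u) \<longlongrightarrow> \<phi> u) G" for u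
    using continuous_on_tendsto_compose[OF continuous_on_product_coordinates[of u], of \<Phi> \<phi> G]
    by (simp add: \<Phi>_def)
  have "bounded_linear \<phi>"
  proof (rule bounded_linear_intro[where K = M])
    show "\<phi> (x + y) = \<phi> x + \<phi> y" for x y
      using tendsto_unique[OF G lim[of "x + y"]] tendsto_add[OF lim[of x] lim[of y]]
      by (simp add: inner_add_right)
    show "\<phi> (r *\<^sub>R x) = r *\<^sub>R \<phi> x" for r x
      using tendsto_unique[OF G lim[of "r *\<^sub>R x"]] tendsto_mult[OF tendsto_const[of r] lim[of x]]
      by simp
    show "norm (\<phi> x) \<le> norm x * M" for x
    proof -
      have "\<phi> x \<in> {- (M * norm x)..M * norm x}" using \<phi> unfolding B_def by blast
      then show ?thesis by (simp add: abs_le_iff mult.commute)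
    qed
  qed
  then obtain a where "\<And>u. \<phi> u = a \<bullet> u" using Riesz_representation by blast
  with lim have "weakly_converges f a G" by (simp add: weakly_converges_def)
  with G_le G show thesis by (rule that)
qed

text \<open>
  Let \<open>a\<close> and \<open>b\<close> be weak cluster points. By polarisation \<open>f t \<bullet> (b - a)\<close> is a combination of
  the squared distances from \<open>f t\<close> to \<open>a\<close> and to \<open>b\<close> and of constants, so it converges along the
  whole filter. Its limit is both \<open>a \<bullet> (b - a)\<close> and \<open>b \<bullet> (b - a)\<close>, which forces \<open>a = b\<close>.
  By compactness, uniqueness of the cluster point means convergence.
\<close>

lemma Opial_weak_convergence:
  fixes f :: "'b \<Rightarrow> 'a::{real_inner, complete_space}"
  assumes F: "F \<noteq> bot" and "S \<noteq> {}"
    and dist: "\<And>s. s \<in> S \<Longrightarrow> \<exists>l. ((\<lambda>t. norm (f t - s)) \<longlongrightarrow> l) F"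
    and cluster: "\<And>G a. G \<le> F \<Longrightarrow> G \<noteq> bot \<Longrightarrow> weakly_converges f a G \<Longrightarrow> a \<in> S"
  shows "\<exists>a\<in>S. weakly_converges f a F"
proof -
  obtain s0 where "s0 \<in> S" using \<open>S \<noteq> {}\<close> by blast
  then obtain l0 where l0: "((\<lambda>t. norm (f t - s0)) \<longlongrightarrow> l0) F" using dist by blast
  then have "\<forall>\<^sub>F t in F. norm (f t - s0) < l0 + 1" by (rule order_tendstoD) simp
  then have bd: "\<forall>\<^sub>F t in F. norm (f t) \<le> l0 + 1 + norm s0"
    by eventually_elim (use norm_triangle_sub in \<open>smt (verit)\<close>)
  obtain G a where G: "G \<le> F" "G \<noteq> bot" "weakly_converges f a G"
    using bounded_imp_weak_cluster_point[OF F bd] by blast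
  have unique: "b = a" if H: "H \<le> F" "H \<noteq> bot" "weakly_converges f b H" for H b
  proof -
    have ab: "a \<in> S" "b \<in> S" using cluster G H by auto
    obtain la lb where la: "((\<lambda>t. norm (f t - a)) \<longlongrightarrow> la) F" and lb: "((\<lambda>t. norm (f t - b)) \<longlongrightarrow> lb) F"
      using dist ab by meson
    have id: "f t \<bullet> (b - a) = ((norm (f t - a))\<^sup>2 - (norm (f t - b))\<^sup>2 + (norm b)\<^sup>2 - (norm a)\<^sup>2) / 2" for t
      unfolding power2_norm_eq_inner by (simp add: inner_commute algebra_simps)
    define L where "L = (la\<^sup>2 - lb\<^sup>2 + (norm b)\<^sup>2 - (norm a)\<^sup>2) / 2"
    have L: "((\<lambda>t. f t \<bullet> (b - a)) \<longlongrightarrow> L) F"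
      unfolding id L_def by (intro tendsto_intros la lb) simp
    have "((\<lambda>t. f t \<bullet> (b - a)) \<longlongrightarrow> L) G" "((\<lambda>t. f t \<bullet> (b - a)) \<longlongrightarrow> L) H"
      using L G(1) H(1) by (auto intro: tendsto_mono)
    then have "a \<bullet> (b - a) = L" "b \<bullet> (b - a) = L"
      using G H by (auto simp: weakly_converges_def intro: tendsto_unique)
    then have "(b - a) \<bullet> (b - a) = 0" by (simp add: inner_diff_left)
    then show ?thesis by simp
  qed
  have "weakly_converges f a F"
    unfolding weakly_converges_def tendsto_iff
  proof (intro allI impI, rule ccontr)
    fix u and e :: real
    assume "e > 0" and not: "\<not> (\<forall>\<^sub>F t in F. dist (f t \<bullet> u) (a \<bullet> u) < e)"
    \<comment> \<open>the refinement of \<open>F\<close> on which \<open>f\<close> stays away from \<open>a\<close>, tested against \<open>u\<close>\<close>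
    define F' where "F' = inf F (principal {t. \<not> dist (f t \<bullet> u) (a \<bullet> u) < e})"
    have F': "F' \<le> F" "F' \<noteq> bot"
      using not by (auto simp: F'_def trivial_limit_def eventually_inf_principal)
    obtain H b where H: "H \<le> F'" "H \<noteq> bot" "weakly_converges f b H"
      using bounded_imp_weak_cluster_point[OF F'(2) filter_leD[OF F'(1) bd]] by blast
    have "b = a" using unique H F'(1) by (meson order_trans)
    with H(3) have "((\<lambda>t. f t \<bullet> u) \<longlongrightarrow> a \<bullet> u) H"
      by (auto simp: weakly_converges_def)
    then have "\<forall>\<^sub>F t in H. dist (f t \<bullet> u) (a \<bullet> u) < e"
      using \<open>e > 0\<close> by (rule tendstoD)
    moreover have "\<forall>\<^sub>F t in H. \<not> dist (f t \<bullet> u) (a \<bullet> u) < e"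
      using H(1) by (rule filter_leD) (simp add: F'_def eventually_inf_principal)
    ultimately have "\<forall>\<^sub>F t in H. False" by eventually_elim simp
    with H(2) show False by (simp add: eventually_False)
  qed
  then show ?thesis using cluster G by blast
qed

text \<open>
  Minty's trick. In the monotonicity inequality between \<open>f t\<close> and an arbitrary point \<open>y\<close> the
  limit can be taken, although \<open>f\<close> converges only weakly, and gives \<open>(y - a) \<bullet> V y \<ge> 0\<close>.
  Approaching \<open>a\<close> by \<open>y = a - s V a\<close> with \<open>s\<close> decreasing to \<open>0\<close> then yields \<open>V a = 0\<close>.
\<close>

lemma monotone_weak_strong_closed:
  fixes V :: "'a::real_inner \<Rightarrow> 'a"
  assumes "monotone_operator V" and "continuous_on UNIV V"
    and "F \<noteq> bot" and "\<forall>\<^sub>F t in F. norm (f t) \<le> M"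
    and w: "weakly_converges f a F" and V0: "((\<lambda>t. V (f t)) \<longlongrightarrow> 0) F"
  shows "V a = 0"
proof -
  have "(y - a) \<bullet> V y \<ge> 0" for y
  proof -
    have "\<forall>\<^sub>F t in F. norm (f t - y) \<le> M + norm y"
      using assms(4) by eventually_elim (use norm_triangle_ineq4 in \<open>smt (verit)\<close>)
    then have "Bfun (\<lambda>t. f t - y) F" by (rule BfunI)
    then have "((\<lambda>t. (f t - y) \<bullet> V (f t)) \<longlongrightarrow> 0) F"
      using V0 unfolding tendsto_Zfun_iff
      by (simp add: bounded_bilinear.Bfun_prod_Zfun[OF bounded_bilinear_inner])
    moreover have "((\<lambda>t. (f t - y) \<bullet> V y) \<longlongrightarrow> a \<bullet> V y - y \<bullet> V y) F"
      unfolding inner_diff_left using tendsto_diff[OF w[unfolded weakly_converges_def, rule_format] tendsto_const] .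
    ultimately have "((\<lambda>t. (f t - y) \<bullet> V (f t) - (f t - y) \<bullet> V y) \<longlongrightarrow> 0 - (a \<bullet> V y - y \<bullet> V y)) F"
      by (rule tendsto_diff)
    then have "0 - (a \<bullet> V y - y \<bullet> V y) \<ge> 0"
    proof (rule tendsto_lowerbound[OF _ _ \<open>F \<noteq> bot\<close>])
      show "\<forall>\<^sub>F t in F. 0 \<le> (f t - y) \<bullet> V (f t) - (f t - y) \<bullet> V y"
        using assms(1) by (intro always_eventually) (simp add: monotone_operator_def inner_diff_right)
    qed
    then show ?thesis by (simp add: inner_diff_left)
  qed
  note minty = this
  have le: "V a \<bullet> V (a - s *\<^sub>R V a) \<le> 0" if "s > 0" for s
    using minty[of "a - s *\<^sub>R V a"] that by (simp add: mult_le_0_iff)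
  have "((\<lambda>s. V (a - s *\<^sub>R V a)) \<longlongrightarrow> V (a - 0 *\<^sub>R V a)) (at_right 0)"
    by (rule continuous_on_tendsto_compose[OF assms(2)])
      (intro tendsto_diff tendsto_scaleR tendsto_const tendsto_ident_at, auto)
  then have "((\<lambda>s. V a \<bullet> V (a - s *\<^sub>R V a)) \<longlongrightarrow> V a \<bullet> V a) (at_right 0)"
    by (intro tendsto_intros) simp
  then have "V a \<bullet> V a \<le> 0"
    by (rule tendsto_upperbound) (auto intro!: eventually_at_right_less[THEN eventually_mono] le)
  then show ?thesis by (metis antisym inner_eq_zero_iff inner_ge_zero)
qed

section \<open>Calculus on the half-line\<close>

lemma has_real_derivative_inner:
  fixes f g :: "real \<Rightarrow> 'a::real_inner"
  assumes "(f has_vector_derivative f') (at t)" "(g has_vector_derivative g') (at t)"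
  shows "((\<lambda>s. f s \<bullet> g s) has_real_derivative f t \<bullet> g' + f' \<bullet> g t) (at t)"
  using bounded_bilinear.has_vector_derivative[OF bounded_bilinear_inner assms]
  by (simp add: has_real_derivative_iff_has_vector_derivative)

lemma has_vector_derivative_imp_difference_quotient:
  fixes f :: "real \<Rightarrow> 'a::real_normed_vector"
  assumes "(f has_vector_derivative f') (at t)"
  shows "((\<lambda>s. (f s - f t) /\<^sub>R (s - t)) \<longlongrightarrow> f') (at t)"
proof (rule Lim_null[THEN iffD2], rule tendsto_norm_zero_cancel)
  have "((\<lambda>s. norm ((f s - f t) - (s - t) *\<^sub>R f') / norm (s - t)) \<longlongrightarrow> 0) (at t)"
    using assms unfolding has_vector_derivative_def has_derivative_iff_norm by simp
  moreover have "norm ((f s - f t) - (s - t) *\<^sub>R f') / norm (s - t) = norm ((f s - f t) /\<^sub>R (s - t) - f')"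
    if "s \<noteq> t" for s
  proof -
    have "(f s - f t) /\<^sub>R (s - t) - f' = inverse (s - t) *\<^sub>R ((f s - f t) - (s - t) *\<^sub>R f')"
      using that by (simp add: scaleR_right_diff_distrib)
    then show ?thesis by (simp add: divide_inverse)
  qed
  ultimately show "((\<lambda>s. norm ((f s - f t) /\<^sub>R (s - t) - f')) \<longlongrightarrow> 0) (at t)"
    by (elim Lim_transform_eventually) (auto simp: eventually_at_filter)
qed

text \<open>
  The inner product of the two difference quotients at \<open>t\<close> is nonnegative by monotonicity.
\<close>

lemma monotone_operator_derivative_nonneg:
  assumes "monotone_operator V"
    and "(z has_vector_derivative v) (at t)"
    and "((\<lambda>s. V (z s)) has_vector_derivative W') (at t)"
  shows "v \<bullet> W' \<ge> 0"
proof -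
  have "((\<lambda>s. ((z s - z t) /\<^sub>R (s - t)) \<bullet> ((V (z s) - V (z t)) /\<^sub>R (s - t))) \<longlongrightarrow> v \<bullet> W') (at t)"
    by (intro tendsto_inner has_vector_derivative_imp_difference_quotient assms(2,3))
  then show ?thesis
  proof (rule tendsto_lowerbound)
    have "0 \<le> ((z s - z t) /\<^sub>R (s - t)) \<bullet> ((V (z s) - V (z t)) /\<^sub>R (s - t))" for s
    proof -
      have "((z s - z t) /\<^sub>R (s - t)) \<bullet> ((V (z s) - V (z t)) /\<^sub>R (s - t))
        = (inverse (s - t))\<^sup>2 * ((z s - z t) \<bullet> (V (z s) - V (z t)))"
        by (simp add: power2_eq_square)
      moreover have "(z s - z t) \<bullet> (V (z s) - V (z t)) \<ge> 0"
        using assms(1) by (simp add: monotone_operator_def)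
      ultimately show ?thesis by (metis mult_nonneg_nonneg zero_le_power2)
    qed
    then show "\<forall>\<^sub>F s in at t. 0 \<le> ((z s - z t) /\<^sub>R (s - t)) \<bullet> ((V (z s) - V (z t)) /\<^sub>R (s - t))"
      by simp
  qed simp
qed

lemma decreasing_bounded_below_convergent_at_top:
  fixes f :: "real \<Rightarrow> real"
  assumes dec: "\<And>s t. T \<le> s \<Longrightarrow> s \<le> t \<Longrightarrow> f t \<le> f s" and lb: "\<And>t. T \<le> t \<Longrightarrow> K \<le> f t"
  shows "\<exists>l. (f \<longlongrightarrow> l) at_top"
proof -
  have bdd: "bdd_below (f ` {T..})" using lb by (intro bdd_belowI[of _ K]) auto
  define l where "l = Inf (f ` {T..})"
  have "(f \<longlongrightarrow> l) at_top"
  proof (rule order_tendstoI)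
    fix a assume "a < l"
    have "l \<le> f t" if "t \<ge> T" for t
      unfolding l_def using bdd that by (intro cInf_lower) auto
    with \<open>a < l\<close> show "\<forall>\<^sub>F t in at_top. a < f t"
      by (intro eventually_mono[OF eventually_ge_at_top[of T]]) (auto intro: less_le_trans)
  next
    fix a assume "l < a"
    then obtain s where "s \<ge> T" "f s < a"
      unfolding l_def using bdd by (subst (asm) cInf_less_iff) auto
    then show "\<forall>\<^sub>F t in at_top. f t < a"
      by (intro eventually_mono[OF eventually_ge_at_top[of s]]) (auto intro: le_less_trans[OF dec])
  qed
  then show ?thesis ..
qed

text \<open>
  The hypothesis controls the derivative of \<open>t powr c * q t\<close>, which is \<open>t powr (c - 1)\<close> times the
  convergent combination. Dividing by the derivative of \<open>t powr c\<close>, the claim is l'Hospital's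
  rule.
\<close>

lemma convergent_if_first_order_combination_convergent:
  fixes q :: "real \<Rightarrow> real"
  assumes "c > 0" and "T \<ge> 0"
    and q': "\<And>t. t > T \<Longrightarrow> (q has_real_derivative q' t) (at t)"
    and lim: "((\<lambda>t. c * q t + t * q' t) \<longlongrightarrow> L) at_top"
  shows "(q \<longlongrightarrow> L / c) at_top"
proof -
  have ev: "\<forall>\<^sub>F t in at_top. t > T" by (rule eventually_gt_at_top)
  have "((\<lambda>t. (t powr c * q t) / t powr c) \<longlongrightarrow> L / c) at_top"
  proof (rule lhospital_at_top_at_top)
    show "LIM t at_top. t powr c :> at_top"
    proof (rule filterlim_cong[THEN iffD2, OF refl refl])
      show "\<forall>\<^sub>F t in at_top. t powr c = exp (c * ln t)"
        using eventually_gt_at_top[of "0::real"] by eventually_elim (simp add: powr_def)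
      show "LIM t at_top. exp (c * ln t) :> at_top"
        by (intro filterlim_compose[OF exp_at_top]
            filterlim_tendsto_pos_mult_at_top[OF tendsto_const \<open>c > 0\<close> ln_at_top])
    qed
    show "\<forall>\<^sub>F t in at_top. c * t powr (c - 1) \<noteq> 0"
      using ev by eventually_elim (use assms in auto)
    show "\<forall>\<^sub>F t in at_top. ((\<lambda>t. t powr c) has_real_derivative c * t powr (c - 1)) (at t)"
      using ev by eventually_elim (use assms in \<open>auto intro!: has_real_derivative_powr\<close>)
    show "\<forall>\<^sub>F t in at_top. ((\<lambda>t. t powr c * q t) has_real_derivative
        t powr (c - 1) * (c * q t + t * q' t)) (at t)"
      using ev
    proof eventually_elim
      case (elim t)
      then have t: "t > 0" using \<open>T \<ge> 0\<close> by simp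
      have pw: "t powr c = t powr (c - 1) * t"
        using t powr_add[of t "c - 1" 1] by simp
      have "((\<lambda>t. t powr c * q t) has_real_derivative
          c * t powr (c - 1) * q t + q' t * t powr c) (at t)"
        by (rule DERIV_mult[OF has_real_derivative_powr[OF t] q'[OF elim]])
      then show ?case by (simp add: pw algebra_simps)
    qed
    have "((\<lambda>t. (c * q t + t * q' t) / c) \<longlongrightarrow> L / c) at_top"
      using \<open>c > 0\<close> by (intro tendsto_intros lim) auto
    then show "((\<lambda>t. t powr (c - 1) * (c * q t + t * q' t) / (c * t powr (c - 1))) \<longlongrightarrow> L / c) at_top"
      by (rule Lim_transform_eventually)
        (use ev in \<open>eventually_elim, use assms in auto\<close>)
  qed
  then show ?thesis
    by (rule Lim_transform_eventually) (use ev in \<open>eventually_elim, use assms in auto\<close>)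
qed

section \<open>The Lyapunov function\<close>

text \<open>
  The customary parameter of this family is the coefficient \<open>\<lambda> = \<alpha> - 1 - \<mu>\<close>. Using the
  complement \<open>\<mu>\<close> puts the dissipative range of the parameter at \<open>[0, \<epsilon>]\<close>.
\<close>

definition energy ::
  "real \<Rightarrow> real \<Rightarrow> (real \<Rightarrow> real) \<Rightarrow> (real \<Rightarrow> 'a::real_inner) \<Rightarrow> (real \<Rightarrow> 'a) \<Rightarrow> (real \<Rightarrow> 'a) \<Rightarrow> real \<Rightarrow> real"
where
  "energy \<alpha> \<mu> \<beta> x v W t =
     (norm ((2 * (\<alpha> - 1 - \<mu>)) *\<^sub>R x t + t *\<^sub>R (2 *\<^sub>R v t + \<beta> t *\<^sub>R W t)))\<^sup>2 / 2
     + 2 * (\<alpha> - 1 - \<mu>) * \<mu> * (norm (x t))\<^sup>2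
     + 2 * (\<alpha> - 1 - \<mu>) * t * \<beta> t * (x t \<bullet> W t)
     + (t * \<beta> t * norm (W t))\<^sup>2 / 2"

text \<open>
  In this form the dependence on the parameter is visible: only the factor in front of the first
  line varies with \<open>\<mu>\<close>.
\<close>

lemma energy_expand:
  "energy \<alpha> \<mu> \<beta> x v W t =
     (\<alpha> - 1 - \<mu>) * (2 * (\<alpha> - 1) * (x t \<bullet> x t) + 4 * t * (x t \<bullet> v t) + 4 * t * \<beta> t * (x t \<bullet> W t))
     + 2 * t\<^sup>2 * (v t \<bullet> v t) + 2 * t\<^sup>2 * \<beta> t * (v t \<bullet> W t) + t\<^sup>2 * (\<beta> t)\<^sup>2 * (W t \<bullet> W t)"
proof -
  have sq: "(norm (c *\<^sub>R x t + t *\<^sub>R (2 *\<^sub>R v t + \<beta> t *\<^sub>R W t)))\<^sup>2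
      = c\<^sup>2 * (x t \<bullet> x t) + 2 * c * t * (2 * (x t \<bullet> v t) + \<beta> t * (x t \<bullet> W t))
        + t\<^sup>2 * (4 * (v t \<bullet> v t) + 4 * \<beta> t * (v t \<bullet> W t) + (\<beta> t)\<^sup>2 * (W t \<bullet> W t))" for c
    unfolding power2_norm_eq_inner
    by (simp add: inner_add_left inner_add_right inner_commute power2_eq_square algebra_simps)
  show ?thesis
    unfolding energy_def sq unfolding power_mult_distrib power2_norm_eq_inner
    by (simp add: power2_eq_square field_simps)
qed

text \<open>
  The cross terms \<open>W \<bullet> W'\<close>, \<open>x \<bullet> v\<close> and \<open>x \<bullet> W'\<close> cancel. The terms in \<open>v \<bullet> v\<close> and \<open>v \<bullet> W\<close>,
  completed to a square, take \<open>t \<mu> \<beta>\<^sup>2 \<parallel>W\<parallel>\<^sup>2\<close> out of the dissipation in \<open>W\<close>; this is the reason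
  for the restriction \<open>\<mu> \<le> \<epsilon>\<close> later on.
\<close>

lemma energy_has_derivative:
  fixes x v W :: "real \<Rightarrow> 'a::real_inner"
  assumes x: "(x has_vector_derivative v t) (at t)"
    and v: "(v has_vector_derivative a) (at t)"
    and W: "(W has_vector_derivative W') (at t)"
    and \<beta>: "(\<beta> has_real_derivative b) (at t)"
    and ode: "a + (\<alpha> / t) *\<^sub>R v t + \<beta> t *\<^sub>R W' + ((1/2) * (b + (\<alpha> / t) * \<beta> t)) *\<^sub>R W t = 0"
    and "t \<noteq> 0"
  shows "(energy \<alpha> \<mu> \<beta> x v W has_real_derivative
     - (2 * (\<alpha> - 1 - \<mu>) * ((\<alpha> - 2) * \<beta> t - t * b) * (x t \<bullet> W t)
        + 2 * t\<^sup>2 * \<beta> t * (v t \<bullet> W')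
        + t * \<mu> * (norm (2 *\<^sub>R v t + \<beta> t *\<^sub>R W t))\<^sup>2
        + t * \<beta> t * ((\<alpha> - 2) * \<beta> t - t * b - \<mu> * \<beta> t) * (norm (W t))\<^sup>2)) (at t)"
proof -
  have a: "t * (y \<bullet> a) = - \<alpha> * (y \<bullet> v t) - t * \<beta> t * (y \<bullet> W') - (t * b + \<alpha> * \<beta> t) / 2 * (y \<bullet> W t)" for y
  proof -
    have "y \<bullet> (a + (\<alpha> / t) *\<^sub>R v t + \<beta> t *\<^sub>R W' + ((1/2) * (b + (\<alpha> / t) * \<beta> t)) *\<^sub>R W t) = 0"
      unfolding ode by simp
    then show ?thesis
      using \<open>t \<noteq> 0\<close> by (simp add: inner_add_right field_simps)
  qed
  \<comment> \<open>The derivative as the product rule gives it, with the acceleration grouped as \<open>t * (y \<bullet> a)\<close>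
    so that the equation of motion in the form above eliminates it.\<close>
  note [derivative_intros] = has_real_derivative_inner[OF x x] has_real_derivative_inner[OF x v]
    has_real_derivative_inner[OF x W] has_real_derivative_inner[OF v v]
    has_real_derivative_inner[OF v W] has_real_derivative_inner[OF W W]
  define D where "D =
     (\<alpha> - 1 - \<mu>) * (4 * (\<alpha> - 1) * (x t \<bullet> v t)
       + 4 * (x t \<bullet> v t) + 4 * t * (v t \<bullet> v t) + 4 * (t * (x t \<bullet> a))
       + 4 * \<beta> t * (x t \<bullet> W t) + 4 * t * b * (x t \<bullet> W t)
       + 4 * t * \<beta> t * (v t \<bullet> W t) + 4 * t * \<beta> t * (x t \<bullet> W'))
     + 4 * t * (v t \<bullet> v t) + 4 * t * (t * (v t \<bullet> a))
     + 4 * t * \<beta> t * (v t \<bullet> W t) + 2 * t\<^sup>2 * b * (v t \<bullet> W t)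
       + 2 * t * \<beta> t * (t * (W t \<bullet> a)) + 2 * t\<^sup>2 * \<beta> t * (v t \<bullet> W')
     + 2 * t * (\<beta> t)\<^sup>2 * (W t \<bullet> W t) + 2 * t\<^sup>2 * \<beta> t * b * (W t \<bullet> W t)
       + 2 * t\<^sup>2 * (\<beta> t)\<^sup>2 * (W t \<bullet> W')"
  have "(energy \<alpha> \<mu> \<beta> x v W has_real_derivative D) (at t)"
    unfolding energy_expand[abs_def] D_def
    by (rule derivative_eq_intros refl \<beta>)+
      (simp add: inner_commute power2_eq_square algebra_simps)
  moreover have "D = - (2 * (\<alpha> - 1 - \<mu>) * ((\<alpha> - 2) * \<beta> t - t * b) * (x t \<bullet> W t)
        + 2 * t\<^sup>2 * \<beta> t * (v t \<bullet> W')
        + t * \<mu> * (norm (2 *\<^sub>R v t + \<beta> t *\<^sub>R W t))\<^sup>2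
        + t * \<beta> t * ((\<alpha> - 2) * \<beta> t - t * b - \<mu> * \<beta> t) * (norm (W t))\<^sup>2)"
    unfolding D_def a power2_norm_eq_inner
    by (simp add: inner_add_left inner_add_right inner_commute power2_eq_square field_simps)
  ultimately show ?thesis by simp
qed

section \<open>Asymptotics of a trajectory relative to one zero\<close>

text \<open>
  Here \<open>x\<close> is the displacement of the trajectory from a zero of the operator, \<open>v\<close> and \<open>a\<close> are
  velocity and acceleration, \<open>W\<close> is the operator along the trajectory, and \<open>b\<close> is the derivative
  of \<open>\<beta>\<close>. Monotonicity enters through the two inequalities \<open>xW_nonneg\<close> and \<open>vW'_nonneg\<close>.
  The time \<open>T\<close> is meant to lie strictly after the initial time, where all derivatives are
  two-sided.
\<close>

locale damped_trajectory =
  fixes \<alpha> \<epsilon> T :: real and \<beta> b :: "real \<Rightarrow> real" and x v a W W' :: "real \<Rightarrow> 'a::real_inner"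
  assumes T_pos: "T > 0" and \<epsilon>_pos: "\<epsilon> > 0" and \<epsilon>_le: "\<epsilon> \<le> \<alpha> - 2"
    and x_deriv: "\<And>t. t \<ge> T \<Longrightarrow> (x has_vector_derivative v t) (at t)"
    and v_deriv: "\<And>t. t \<ge> T \<Longrightarrow> (v has_vector_derivative a t) (at t)"
    and W_deriv: "\<And>t. t \<ge> T \<Longrightarrow> (W has_vector_derivative W' t) (at t)"
    and \<beta>_deriv: "\<And>t. t \<ge> T \<Longrightarrow> (\<beta> has_real_derivative b t) (at t)"
    and ode: "\<And>t. t \<ge> T \<Longrightarrow>
      a t + (\<alpha> / t) *\<^sub>R v t + \<beta> t *\<^sub>R W' t + ((1/2) * (b t + (\<alpha> / t) * \<beta> t)) *\<^sub>R W t = 0"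
    and \<beta>_pos: "\<And>t. t \<ge> T \<Longrightarrow> \<beta> t > 0"
    and growth: "\<And>t. t \<ge> T \<Longrightarrow> t * b t \<le> (\<alpha> - 2 - \<epsilon>) * \<beta> t"
    and xW_nonneg: "\<And>t. t \<ge> T \<Longrightarrow> x t \<bullet> W t \<ge> 0"
    and vW'_nonneg: "\<And>t. t \<ge> T \<Longrightarrow> v t \<bullet> W' t \<ge> 0"
begin

lemma energy_bounds:
  assumes "0 \<le> \<mu>" "\<mu> \<le> \<epsilon>" "t \<ge> T"
  shows "energy \<alpha> \<mu> \<beta> x v W t \<ge> 0"
    and "energy \<alpha> \<mu> \<beta> x v W t \<ge> (t * \<beta> t * norm (W t))\<^sup>2 / 2"
proof -
  have "\<alpha> - 1 - \<mu> \<ge> 0" "t > 0" "\<beta> t > 0" "x t \<bullet> W t \<ge> 0"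
    using assms T_pos \<epsilon>_le \<beta>_pos xW_nonneg by auto
  then show ge: "energy \<alpha> \<mu> \<beta> x v W t \<ge> (t * \<beta> t * norm (W t))\<^sup>2 / 2"
    using \<open>0 \<le> \<mu>\<close> unfolding energy_def by (simp add: add_nonneg_nonneg)
  show "energy \<alpha> \<mu> \<beta> x v W t \<ge> 0"
    by (rule order_trans[OF _ ge]) simp
qed

text \<open>
  Of the four dissipation terms only the one in \<open>x \<bullet> W\<close> is kept; its integrability is what
  the convergence of the distance rests on.
\<close>

lemma energy_dissipation:
  assumes "0 \<le> \<mu>" "\<mu> \<le> \<epsilon>" "t \<ge> T"
  obtains D where "(energy \<alpha> \<mu> \<beta> x v W has_real_derivative D) (at t)"
    and "D \<le> - (2 * (\<alpha> - 1 - \<mu>) * \<epsilon> * (\<beta> t * (x t \<bullet> W t)))"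
proof -
  have t: "t > 0" and \<beta>: "\<beta> t > 0" using assms T_pos \<beta>_pos by auto
  have \<lambda>: "\<alpha> - 1 - \<mu> \<ge> 0" using assms \<epsilon>_le by simp
  have w: "\<epsilon> * \<beta> t \<le> (\<alpha> - 2) * \<beta> t - t * b t"
    using growth[OF \<open>t \<ge> T\<close>] by (simp add: algebra_simps)
  define w where "w = (\<alpha> - 2) * \<beta> t - t * b t"
  have "w - \<mu> * \<beta> t \<ge> 0"
    using w mult_right_mono[OF \<open>\<mu> \<le> \<epsilon>\<close>, of "\<beta> t"] \<beta> unfolding w_def by linarith
  then have "t * \<beta> t * (w - \<mu> * \<beta> t) * (norm (W t))\<^sup>2 \<ge> 0"
    using t \<beta> by (intro mult_nonneg_nonneg) auto
  moreover have "2 * (\<alpha> - 1 - \<mu>) * \<epsilon> * (\<beta> t * (x t \<bullet> W t)) \<le> 2 * (\<alpha> - 1 - \<mu>) * w * (x t \<bullet> W t)"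
    using mult_left_mono[OF mult_right_mono[OF w xW_nonneg[OF \<open>t \<ge> T\<close>]], of "2 * (\<alpha> - 1 - \<mu>)"] \<lambda>
    by (simp add: w_def mult.assoc)
  moreover have "2 * t\<^sup>2 * \<beta> t * (v t \<bullet> W' t) \<ge> 0"
    using \<beta> vW'_nonneg[OF \<open>t \<ge> T\<close>] by simp
  moreover have "t * \<mu> * (norm (2 *\<^sub>R v t + \<beta> t *\<^sub>R W t))\<^sup>2 \<ge> 0"
    using t \<open>0 \<le> \<mu>\<close> by simp
  ultimately have "- (2 * (\<alpha> - 1 - \<mu>) * w * (x t \<bullet> W t)
        + 2 * t\<^sup>2 * \<beta> t * (v t \<bullet> W' t)
        + t * \<mu> * (norm (2 *\<^sub>R v t + \<beta> t *\<^sub>R W t))\<^sup>2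
        + t * \<beta> t * (w - \<mu> * \<beta> t) * (norm (W t))\<^sup>2)
      \<le> - (2 * (\<alpha> - 1 - \<mu>) * \<epsilon> * (\<beta> t * (x t \<bullet> W t)))"
    by linarith
  with energy_has_derivative[OF x_deriv v_deriv W_deriv \<beta>_deriv ode, of t \<mu>] \<open>t \<ge> T\<close> t
  show thesis by (intro that) (auto simp: w_def)
qed

lemma energy_antimono:
  assumes "0 \<le> \<mu>" "\<mu> \<le> \<epsilon>" "T \<le> s" "s \<le> t"
  shows "energy \<alpha> \<mu> \<beta> x v W t \<le> energy \<alpha> \<mu> \<beta> x v W s"
proof (rule DERIV_nonpos_imp_nonincreasing[OF \<open>s \<le> t\<close>])
  fix r assume "s \<le> r" "r \<le> t"
  then have r: "r \<ge> T" using assms by simp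
  obtain D where "(energy \<alpha> \<mu> \<beta> x v W has_real_derivative D) (at r)"
    and D: "D \<le> - (2 * (\<alpha> - 1 - \<mu>) * \<epsilon> * (\<beta> r * (x r \<bullet> W r)))"
    using energy_dissipation[OF assms(1,2) r] .
  moreover have "2 * (\<alpha> - 1 - \<mu>) * \<epsilon> * (\<beta> r * (x r \<bullet> W r)) \<ge> 0"
    using assms \<epsilon>_pos \<epsilon>_le \<beta>_pos[OF r] xW_nonneg[OF r] by simp
  ultimately show "\<exists>y. (energy \<alpha> \<mu> \<beta> x v W has_real_derivative y) (at r) \<and> y \<le> 0"
    by (meson neg_le_0_iff_le order_trans)
qed

lemma energy_convergent:
  assumes "0 \<le> \<mu>" "\<mu> \<le> \<epsilon>"
  shows "\<exists>l. (energy \<alpha> \<mu> \<beta> x v W \<longlongrightarrow> l) at_top"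
  using energy_antimono[OF assms] energy_bounds(1)[OF assms]
  by (intro decreasing_bounded_below_convergent_at_top[of T _ 0])

lemma scaled_W_bounded: "\<exists>K. \<forall>t\<ge>T. t * \<beta> t * norm (W t) \<le> K"
proof -
  have "t * \<beta> t * norm (W t) \<le> sqrt (2 * energy \<alpha> 0 \<beta> x v W T)" if t: "t \<ge> T" for t
  proof (rule real_le_rsqrt)
    have "(t * \<beta> t * norm (W t))\<^sup>2 / 2 \<le> energy \<alpha> 0 \<beta> x v W t"
      using \<epsilon>_pos t by (intro energy_bounds(2)) auto
    also have "\<dots> \<le> energy \<alpha> 0 \<beta> x v W T"
      using \<epsilon>_pos t by (intro energy_antimono) auto
    finally show "(t * \<beta> t * norm (W t))\<^sup>2 \<le> 2 * energy \<alpha> 0 \<beta> x v W T" by linarith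
  qed
  then show ?thesis by blast
qed

text \<open>
  The dissipation makes a positive multiple of \<open>G\<close>, added to the energy at \<open>\<mu> = \<epsilon>\<close>, nonincreasing. That
  sum is bounded below, so it converges, and so does the energy alone.
\<close>

lemma integral_xW_convergent:
  defines "G \<equiv> \<lambda>t. integral {T..t} (\<lambda>s. \<beta> s * (x s \<bullet> W s))"
  shows "\<And>t. t > T \<Longrightarrow> (G has_real_derivative \<beta> t * (x t \<bullet> W t)) (at t)"
    and "\<exists>l. (G \<longlongrightarrow> l) at_top"
proof -
  let ?g = "\<lambda>s. \<beta> s * (x s \<bullet> W s)"
  have cont: "continuous_on {T..c} ?g" for c
  proof (rule continuous_at_imp_continuous_on, rule ballI)
    fix t assume "t \<in> {T..c}"
    then have t: "t \<ge> T" by simp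
    show "isCont ?g t"
      using DERIV_isCont[OF DERIV_mult[OF \<beta>_deriv[OF t]
            has_real_derivative_inner[OF x_deriv[OF t] W_deriv[OF t]]]] .
  qed
  show G': "(G has_real_derivative ?g t) (at t)" if "t > T" for t
  proof -
    have "(G has_real_derivative ?g t) (at t within {T..t + 1})"
      unfolding G_def using that by (intro integral_has_real_derivative cont) auto
    then show ?thesis
      using that at_within_Icc_at[of T t "t + 1"] by simp
  qed
  define E where "E = energy \<alpha> \<epsilon> \<beta> x v W"
  define c where "c = 2 * (\<alpha> - 1 - \<epsilon>) * \<epsilon>"
  have c: "c > 0" using \<epsilon>_pos \<epsilon>_le by (simp add: c_def)
  have E: "\<exists>l. (E \<longlongrightarrow> l) at_top"
    unfolding E_def by (rule energy_convergent) (use \<epsilon>_pos in simp_all)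
  have G_nonneg: "G t \<ge> 0" if "t \<ge> T" for t
    unfolding G_def using \<beta>_pos xW_nonneg
    by (intro integral_nonneg integrable_continuous_real cont mult_nonneg_nonneg) (auto intro: less_imp_le)
  have "\<exists>l. ((\<lambda>t. E t + c * G t) \<longlongrightarrow> l) at_top"
  proof (rule decreasing_bounded_below_convergent_at_top[of "T + 1" _ 0])
    fix s t assume st: "T + 1 \<le> s" "s \<le> t"
    show "E t + c * G t \<le> E s + c * G s"
    proof (rule DERIV_nonpos_imp_nonincreasing[OF \<open>s \<le> t\<close>])
      fix r assume "s \<le> r" "r \<le> t"
      then have r: "r > T" using st by simp
      obtain D where D: "(E has_real_derivative D) (at r)" "D \<le> - (c * ?g r)"
        unfolding E_def c_def
        by (rule energy_dissipation[of \<epsilon> r]) (use \<epsilon>_pos r in simp_all)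
      have "((\<lambda>t. E t + c * G t) has_real_derivative D + c * ?g r) (at r)"
        by (rule DERIV_add[OF D(1) DERIV_cmult[OF G'[OF r]]])
      with D(2) show "\<exists>y. ((\<lambda>t. E t + c * G t) has_real_derivative y) (at r) \<and> y \<le> 0"
        by (intro exI[of _ "D + c * ?g r"]) auto
    qed
  next
    fix t assume "T + 1 \<le> t"
    then show "0 \<le> E t + c * G t"
      using energy_bounds(1)[of \<epsilon> t] G_nonneg[of t] \<epsilon>_pos c by (simp add: E_def)
  qed
  with E obtain l m where "(E \<longlongrightarrow> l) at_top" "((\<lambda>t. E t + c * G t) \<longlongrightarrow> m) at_top" by blast
  then have "((\<lambda>t. ((E t + c * G t) - E t) / c) \<longlongrightarrow> (m - l) / c) at_top"
    using c by (intro tendsto_intros) auto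
  then show "\<exists>l. (G \<longlongrightarrow> l) at_top" using c by auto
qed

text \<open>
  The two parameters \<open>\<epsilon> / 2\<close> and \<open>\<epsilon>\<close> stand for any two values in the dissipative range: the
  difference of the corresponding energies isolates the quantity \<open>p\<close>, in which \<open>\<parallel>x\<parallel>\<^sup>2\<close> appears
  together with its derivative.
\<close>

lemma distance_convergent: "\<exists>l. ((\<lambda>t. norm (x t)) \<longlongrightarrow> l) at_top"
proof -
  define G where "G = (\<lambda>t. integral {T..t} (\<lambda>s. \<beta> s * (x s \<bullet> W s)))"
  have G': "(G has_real_derivative \<beta> t * (x t \<bullet> W t)) (at t)" if "t > T" for t
    unfolding G_def using that by (rule integral_xW_convergent(1))
  obtain g where g: "(G \<longlongrightarrow> g) at_top"
    using integral_xW_convergent(2) unfolding G_def by blast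
  define p where "p = (\<lambda>t. (\<alpha> - 1) * (x t \<bullet> x t) / 2 + t * (x t \<bullet> v t) + t * \<beta> t * (x t \<bullet> W t))"
  obtain e1 where e1: "(energy \<alpha> (\<epsilon> / 2) \<beta> x v W \<longlongrightarrow> e1) at_top"
    using energy_convergent[of "\<epsilon> / 2"] \<epsilon>_pos by auto
  obtain e2 where e2: "(energy \<alpha> \<epsilon> \<beta> x v W \<longlongrightarrow> e2) at_top"
    using energy_convergent[of \<epsilon>] \<epsilon>_pos by auto
  have "p t = (energy \<alpha> (\<epsilon> / 2) \<beta> x v W t - energy \<alpha> \<epsilon> \<beta> x v W t) / (2 * \<epsilon>)" for t
    unfolding energy_expand p_def using \<epsilon>_pos by (simp add: field_simps)
  moreover have "((\<lambda>t. (energy \<alpha> (\<epsilon> / 2) \<beta> x v W t - energy \<alpha> \<epsilon> \<beta> x v W t) / (2 * \<epsilon>))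
      \<longlongrightarrow> (e1 - e2) / (2 * \<epsilon>)) at_top"
    using \<epsilon>_pos by (intro tendsto_intros e1 e2) auto
  ultimately have p: "(p \<longlongrightarrow> (e1 - e2) / (2 * \<epsilon>)) at_top" by presburger
  define q where "q = (\<lambda>t. (x t \<bullet> x t) / 2 + G t)"
  define q' where "q' = (\<lambda>t. x t \<bullet> v t + \<beta> t * (x t \<bullet> W t))"
  have "(q has_real_derivative q' t) (at t)" if "t > T" for t
    unfolding q_def q'_def using that
    by (auto intro!: derivative_eq_intros G' has_real_derivative_inner[OF x_deriv x_deriv]
        simp: inner_commute)
  moreover have "((\<lambda>t. (\<alpha> - 1) * q t + t * q' t) \<longlongrightarrow> (e1 - e2) / (2 * \<epsilon>) + (\<alpha> - 1) * g) at_top"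
  proof -
    have "(\<lambda>t. (\<alpha> - 1) * q t + t * q' t) = (\<lambda>t. p t + (\<alpha> - 1) * G t)"
      by (auto simp: p_def q_def q'_def algebra_simps)
    then show ?thesis by (simp only:) (intro tendsto_intros p g)
  qed
  ultimately have "(q \<longlongrightarrow> ((e1 - e2) / (2 * \<epsilon>) + (\<alpha> - 1) * g) / (\<alpha> - 1)) at_top"
    using \<epsilon>_pos \<epsilon>_le T_pos by (intro convergent_if_first_order_combination_convergent[of _ T]) auto
  then obtain l where "(q \<longlongrightarrow> l) at_top" by blast
  then have "((\<lambda>t. sqrt (2 * (q t - G t))) \<longlongrightarrow> sqrt (2 * (l - g))) at_top"
    by (intro tendsto_intros g)
  then show ?thesis by (auto simp: q_def norm_eq_sqrt_inner)
qed

end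

section \<open>Weak convergence to a zero\<close>

theorem theorem6:
  fixes V :: "'a::{real_inner, complete_space} \<Rightarrow> 'a"
    and \<alpha> t0 :: real
    and \<beta> :: "real \<Rightarrow> real"
    and z0 v0 :: 'a
    and z :: "real \<Rightarrow> 'a"
  assumes "monotone_operator V"
    and "continuous_on UNIV V"
    and "{x. V x = 0} \<noteq> {}"
    and "t0 > 0"
    and "\<And>t. t \<ge> t0 \<Longrightarrow> \<beta> t > 0"
    and "\<beta> differentiable_on {t0..}"
    and "continuous_on {t0..} (time_deriv t0 \<beta>)"
    and "mono_on {t0..} \<beta>"
    and "\<alpha> > 2"
    and "DS_solution V \<alpha> \<beta> t0 z0 v0 z"
    and "0 \<le> (SUP t\<in>{t0..}. ereal (t * time_deriv t0 \<beta> t / \<beta> t))"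
    and "(SUP t\<in>{t0..}. ereal (t * time_deriv t0 \<beta> t / \<beta> t)) < ereal (\<alpha> - 2)"
  shows "\<exists>zinf. V zinf = 0 \<and> weakly_converges z zinf at_top"
proof -
  have deriv: "(f has_vector_derivative time_deriv t0 f t) (at t)"
    if "f differentiable_on {t0..}" "t > t0" for t and f :: "real \<Rightarrow> 'b::real_normed_vector"
  proof -
    have "f differentiable (at t within {t0..})"
      using that by (simp add: differentiable_on_def)
    then have "(f has_vector_derivative time_deriv t0 f t) (at t within {t0..})"
      unfolding time_deriv_def by (simp add: vector_derivative_works)
    then show ?thesis using that(2) at_within_interior[of t "{t0..}"] by simp
  qed
  obtain \<sigma> where \<sigma>: "(SUP t\<in>{t0..}. ereal (t * time_deriv t0 \<beta> t / \<beta> t)) = ereal \<sigma>"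
    using assms(11,12) by (cases "SUP t\<in>{t0..}. ereal (t * time_deriv t0 \<beta> t / \<beta> t)") auto
  define \<epsilon> where "\<epsilon> = \<alpha> - 2 - \<sigma>"
  have \<epsilon>: "\<epsilon> > 0" "\<epsilon> \<le> \<alpha> - 2" using assms(11,12) by (auto simp: \<sigma> \<epsilon>_def zero_ereal_def)
  have growth: "t * time_deriv t0 \<beta> t \<le> (\<alpha> - 2 - \<epsilon>) * \<beta> t" if "t \<ge> t0" for t
  proof -
    have "ereal (t * time_deriv t0 \<beta> t / \<beta> t) \<le> ereal \<sigma>"
      unfolding \<sigma>[symmetric] using that by (intro SUP_upper) auto
    then show ?thesis using assms(5)[OF that] by (simp add: \<epsilon>_def field_simps)
  qed
  define W where "W = (\<lambda>t. V (z t))"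
  have sol: "z differentiable_on {t0..}" "time_deriv t0 z differentiable_on {t0..}"
    "W differentiable_on {t0..}"
    and ode: "\<And>t. t \<ge> t0 \<Longrightarrow>
        time_deriv t0 (time_deriv t0 z) t + (\<alpha> / t) *\<^sub>R time_deriv t0 z t
        + \<beta> t *\<^sub>R time_deriv t0 W t
        + ((1/2) * (time_deriv t0 \<beta> t + (\<alpha> / t) * \<beta> t)) *\<^sub>R W t = 0"
    using assms(10) by (auto simp: DS_solution_def W_def)
  \<comment> \<open>Any time after \<open>t0\<close> would do: there the one-sided derivatives are two-sided.\<close>
  define T where "T = t0 + 1"
  have T: "T > t0" "T > 0" using \<open>t0 > 0\<close> by (auto simp: T_def)
  have trajectory: "damped_trajectory \<alpha> \<epsilon> T \<beta> (time_deriv t0 \<beta>) (\<lambda>t. z t - s) (time_deriv t0 z)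
      (time_deriv t0 (time_deriv t0 z)) W (time_deriv t0 W)" if "V s = 0" for s
  proof
    fix t assume "t \<ge> T"
    then have t: "t > t0" using T by simp
    show "((\<lambda>t. z t - s) has_vector_derivative time_deriv t0 z t) (at t)"
      using has_vector_derivative_diff_const[of z s] deriv[OF sol(1) t] by auto
    show "(time_deriv t0 z has_vector_derivative time_deriv t0 (time_deriv t0 z) t) (at t)"
      by (rule deriv[OF sol(2) t])
    show W': "(W has_vector_derivative time_deriv t0 W t) (at t)"
      by (rule deriv[OF sol(3) t])
    show "(\<beta> has_real_derivative time_deriv t0 \<beta> t) (at t)"
      using deriv[OF assms(6) t] by (simp add: has_real_derivative_iff_has_vector_derivative)
    show "0 \<le> (z t - s) \<bullet> W t"
      using assms(1) that unfolding monotone_operator_def W_def by (metis diff_zero)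
    show "0 \<le> time_deriv t0 z t \<bullet> time_deriv t0 W t"
      using monotone_operator_derivative_nonneg[OF assms(1) deriv[OF sol(1) t] W'[unfolded W_def]]
      by (simp add: W_def)
  qed (use T \<epsilon> ode growth assms(5) in auto)
  obtain s0 where s0: "V s0 = 0" using assms(3) by blast
  interpret s0: damped_trajectory \<alpha> \<epsilon> T \<beta> "time_deriv t0 \<beta>" "\<lambda>t. z t - s0" "time_deriv t0 z"
      "time_deriv t0 (time_deriv t0 z)" W "time_deriv t0 W"
    by (rule trajectory[OF s0])
  have W0: "(W \<longlongrightarrow> 0) at_top"
  proof -
    obtain K where K: "\<And>t. t \<ge> T \<Longrightarrow> t * \<beta> t * norm (W t) \<le> K"
      using s0.scaled_W_bounded by blast
    have "norm (W t) \<le> K / \<beta> t0 / t" if "t \<ge> T" for t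
    proof -
      have t: "t > 0" "t \<ge> t0" using that T by auto
      have "\<beta> t0 \<le> \<beta> t" using assms(8) t(2) by (auto elim: mono_onD)
      then have "t * \<beta> t0 * norm (W t) \<le> t * \<beta> t * norm (W t)"
        using t by (intro mult_right_mono mult_left_mono) auto
      also have "\<dots> \<le> K" by (rule K[OF that])
      finally show ?thesis
        using t assms(5)[of t0] by (simp add: field_simps)
    qed
    then have "\<forall>\<^sub>F t in at_top. norm (W t) \<le> K / \<beta> t0 / t"
      by (rule eventually_mono[OF eventually_ge_at_top])
    moreover have "((\<lambda>t. K / \<beta> t0 / t) \<longlongrightarrow> 0) at_top"
      by (intro tendsto_divide_0[OF tendsto_const] filterlim_at_top_imp_at_infinity filterlim_ident)
    ultimately show ?thesis by (rule Lim_null_comparison)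
  qed
  obtain l0 where "((\<lambda>t. norm (z t - s0)) \<longlongrightarrow> l0) at_top"
    using s0.distance_convergent by blast
  then have "\<forall>\<^sub>F t in at_top. norm (z t - s0) < l0 + 1" by (rule order_tendstoD) simp
  then have bd: "\<forall>\<^sub>F t in at_top. norm (z t) \<le> l0 + 1 + norm s0"
    by eventually_elim (use norm_triangle_sub in \<open>smt (verit)\<close>)
  have "\<exists>zinf\<in>{x. V x = 0}. weakly_converges z zinf at_top"
  proof (rule Opial_weak_convergence[OF _ assms(3)])
    show "\<exists>l. ((\<lambda>t. norm (z t - s)) \<longlongrightarrow> l) at_top" if "s \<in> {x. V x = 0}" for s
      using damped_trajectory.distance_convergent[OF trajectory] that by blast
    show "a \<in> {x. V x = 0}" if "G \<le> at_top" "G \<noteq> bot" "weakly_converges z a G" for G a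
      using monotone_weak_strong_closed[OF assms(1,2) that(2) filter_leD[OF that(1) bd] that(3)]
        tendsto_mono[OF that(1) W0] by (simp add: W_def)
  qed simp
  then show ?thesis by blast
qed

end
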